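(* Let $n\ge 1$, let $F(n)$ be the free five-valued Nelson algebra with set of free generators $G=\{g_1,\dots,g_n\}$, and let $C_5=\{0,\tfrac14,\tfrac12,\tfrac34,1\}$. For $f\colon G\to C_5$ let $\bar f\colon F(n)\to C_5$ be the unique homomorphism extending $f$, put $P_f=\{x\in F(n):\bar f(x)=1\}$ and $f_i=f(g_i)$. Then for $f,h\colon G\to C_5$ we have $P_h\subsetneq P_f$ if and only if all the following hold: (1) $f_i\in\{0,\tfrac12,1\}$ for every $i$; (2) $f_i\neq h_i$ for at least one $i$; (3) for every $i$, if $f_i=0$ then $h_i\in\{0,\tfrac14\}$; (4) for every $i$, if $f_i=1$ then $h_i\in\{1,\tfrac34\}$; (5) for every $i$, $h_i=\tfrac12$ if and only if $f_i=\tfrac12$.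
   Context: A Nelson algebra is an algebra $(N,1,\sim,\wedge,\vee,\to)$ of type $(0,1,2,2,2)$ satisfying, for all $x,y,z$: $x\wedge(x\vee y)=x$; $x\wedge(y\vee z)=(z\wedge x)\vee(y\wedge x)$; $\sim\sim x=x$; $\sim(x\vee y)=\sim x\vee\sim y$; $x\wedge\sim x=(x\wedge\sim x)\wedge(y\vee\sim y)$; $x\to x=1$; $x\to(y\to z)=(x\wedge y)\to z$; $x\wedge(x\to y)=x\wedge(\sim x\vee y)$. It is five-valued if it satisfies $((x\to z)\to y)\to(((y\to x)\to y)\to y)=1$. $F(n)$ is the free algebra on $n$ free generators in the variety of five-valued Nelson algebras. $C_5$ is the chain $0<\tfrac14<\tfrac12<\tfrac34<1$ with lattice operations min and max, $\sim x=1-x$, and $x\to y=1$ if $x\le y$ or $x\le \sim x$, and $x\to y=\sim x\vee y$ otherwise; it is a five-valued Nelson algebra.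
   Formalization: The De Morgan axiom of Nelson algebras is taken as ~(x∧y) = ~x∨~y instead of the printed ~(x∨y) = ~x∨~y, which fails in C_5 at x=0, y=1. *)

theory Defs
  imports Complex_Main "HOL-Library.FuncSet"
begin

section \<open>Five-valued Nelson algebras\<close>

record 'a nelson_struct =
  carrier :: "'a set"
  nel_one :: 'a  ("\<one>\<index>")
  nel_neg :: "'a \<Rightarrow> 'a"  ("\<sim>\<index> _" [81] 80)
  nel_meet :: "'a \<Rightarrow> 'a \<Rightarrow> 'a"  (infixl "\<sqinter>\<index>" 70)
  nel_join :: "'a \<Rightarrow> 'a \<Rightarrow> 'a"  (infixl "\<squnion>\<index>" 65)
  nel_imp :: "'a \<Rightarrow> 'a \<Rightarrow> 'a"  (infixr "\<leadsto>\<index>" 60)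

text \<open>Axiom \<open>neg_meet\<close> is the De Morgan law. The variant \<open>\<sim> (x \<squnion> y) = \<sim> x \<squnion> \<sim> y\<close>
  found in print is a misprint: it fails in the chain \<open>C5\<close> below for \<open>x = 0\<close>, \<open>y = 1\<close>.\<close>

locale nelson_algebra =
  fixes N (structure)
  assumes one_closed [simp, intro]: "\<one> \<in> carrier N"
    and neg_closed [simp, intro]: "x \<in> carrier N \<Longrightarrow> \<sim> x \<in> carrier N"
    and meet_closed [simp, intro]: "\<lbrakk>x \<in> carrier N; y \<in> carrier N\<rbrakk> \<Longrightarrow> x \<sqinter> y \<in> carrier N"
    and join_closed [simp, intro]: "\<lbrakk>x \<in> carrier N; y \<in> carrier N\<rbrakk> \<Longrightarrow> x \<squnion> y \<in> carrier N"
    and imp_closed [simp, intro]: "\<lbrakk>x \<in> carrier N; y \<in> carrier N\<rbrakk> \<Longrightarrow> x \<leadsto> y \<in> carrier N"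
    and absorb: "\<lbrakk>x \<in> carrier N; y \<in> carrier N\<rbrakk> \<Longrightarrow> x \<sqinter> (x \<squnion> y) = x"
    and distrib: "\<lbrakk>x \<in> carrier N; y \<in> carrier N; z \<in> carrier N\<rbrakk>
          \<Longrightarrow> x \<sqinter> (y \<squnion> z) = (z \<sqinter> x) \<squnion> (y \<sqinter> x)"
    and neg_neg: "x \<in> carrier N \<Longrightarrow> \<sim> (\<sim> x) = x"
    and neg_meet: "\<lbrakk>x \<in> carrier N; y \<in> carrier N\<rbrakk> \<Longrightarrow> \<sim> (x \<sqinter> y) = (\<sim> x) \<squnion> (\<sim> y)"
    and kleene: "\<lbrakk>x \<in> carrier N; y \<in> carrier N\<rbrakk>
          \<Longrightarrow> x \<sqinter> (\<sim> x) = (x \<sqinter> (\<sim> x)) \<sqinter> (y \<squnion> (\<sim> y))"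
    and imp_self: "x \<in> carrier N \<Longrightarrow> x \<leadsto> x = \<one>"
    and imp_imp: "\<lbrakk>x \<in> carrier N; y \<in> carrier N; z \<in> carrier N\<rbrakk>
          \<Longrightarrow> x \<leadsto> (y \<leadsto> z) = (x \<sqinter> y) \<leadsto> z"
    and meet_imp: "\<lbrakk>x \<in> carrier N; y \<in> carrier N\<rbrakk>
          \<Longrightarrow> x \<sqinter> (x \<leadsto> y) = x \<sqinter> ((\<sim> x) \<squnion> y)"

lemma (in nelson_algebra) neg_join:
  assumes "x \<in> carrier N" "y \<in> carrier N"
  shows "\<sim> (x \<squnion> y) = (\<sim> x) \<sqinter> (\<sim> y)"
  using assms by (metis meet_closed neg_closed neg_meet neg_neg)

locale five_valued_nelson_algebra = nelson_algebra +
  assumes five_valued: "\<lbrakk>x \<in> carrier N; y \<in> carrier N; z \<in> carrier N\<rbrakk>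
          \<Longrightarrow> ((x \<leadsto> z) \<leadsto> y) \<leadsto> (((y \<leadsto> x) \<leadsto> y) \<leadsto> y) = \<one>"

text \<open>Homomorphisms are extensional functions, so that equality of homomorphisms is
  equality on the carrier.\<close>

definition nelson_hom ::
  "('a, 'm) nelson_struct_scheme \<Rightarrow> ('b, 'k) nelson_struct_scheme \<Rightarrow> ('a \<Rightarrow> 'b) set" where
  "nelson_hom A B = {\<phi> \<in> carrier A \<rightarrow>\<^sub>E carrier B.
     \<phi> \<one>\<^bsub>A\<^esub> = \<one>\<^bsub>B\<^esub> \<and>
     (\<forall>x\<in>carrier A. \<phi> (\<sim>\<^bsub>A\<^esub> x) = \<sim>\<^bsub>B\<^esub> (\<phi> x)) \<and>
     (\<forall>x\<in>carrier A. \<forall>y\<in>carrier A. \<phi> (x \<sqinter>\<^bsub>A\<^esub> y) = \<phi> x \<sqinter>\<^bsub>B\<^esub> \<phi> y) \<and>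
     (\<forall>x\<in>carrier A. \<forall>y\<in>carrier A. \<phi> (x \<squnion>\<^bsub>A\<^esub> y) = \<phi> x \<squnion>\<^bsub>B\<^esub> \<phi> y) \<and>
     (\<forall>x\<in>carrier A. \<forall>y\<in>carrier A. \<phi> (x \<leadsto>\<^bsub>A\<^esub> y) = \<phi> x \<leadsto>\<^bsub>B\<^esub> \<phi> y)}"


section \<open>The chain with five elements\<close>

definition C5 :: "rat nelson_struct" where
  "C5 = \<lparr> carrier = {0, 1/4, 1/2, 3/4, 1},
          nel_one = 1,
          nel_neg = (\<lambda>x. 1 - x),
          nel_meet = min,
          nel_join = max,
          nel_imp = (\<lambda>x y. if x \<le> y \<or> x \<le> 1 - x then 1 else max (1 - x) y) \<rparr>"

lemma five_valued_nelson_algebra_C5: "five_valued_nelson_algebra C5"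
proof -
  have all5: "(\<forall>x\<in>carrier C5. Q x) \<longleftrightarrow> Q 0 \<and> Q (1/4) \<and> Q (1/2) \<and> Q (3/4) \<and> Q 1" for Q
    by (simp add: C5_def)
  have bin: "(\<forall>x\<in>carrier C5. \<forall>y\<in>carrier C5. R x y) \<Longrightarrow>
      x \<in> carrier C5 \<Longrightarrow> y \<in> carrier C5 \<Longrightarrow> R x y" for R x y by blast
  have tern: "(\<forall>x\<in>carrier C5. \<forall>y\<in>carrier C5. \<forall>z\<in>carrier C5. R x y z) \<Longrightarrow>
      x \<in> carrier C5 \<Longrightarrow> y \<in> carrier C5 \<Longrightarrow> z \<in> carrier C5 \<Longrightarrow> R x y z" for R x y z by blast
  show ?thesis
  proof (unfold_locales, goal_cases)
    case (3 x y) then show ?case by (rule bin[rotated]) (unfold all5, simp add: C5_def)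
  next
    case (4 x y) then show ?case by (rule bin[rotated]) (unfold all5, simp add: C5_def)
  next
    case (5 x y) then show ?case by (rule bin[rotated]) (unfold all5, simp add: C5_def)
  next
    case (6 x y) then show ?case by (rule bin[rotated]) (unfold all5, simp add: C5_def)
  next
    case (7 x y z) then show ?case by (rule tern[rotated]) (unfold all5, simp add: C5_def)
  next
    case (9 x y) then show ?case by (rule bin[rotated]) (unfold all5, simp add: C5_def)
  next
    case (10 x y) then show ?case by (rule bin[rotated]) (unfold all5, simp add: C5_def)
  next
    case (12 x y z) then show ?case by (rule tern[rotated]) (unfold all5, simp add: C5_def)
  next
    case (13 x y) then show ?case by (rule bin[rotated]) (unfold all5, simp add: C5_def)
  next
    case (14 x y z) then show ?case by (rule tern[rotated]) (unfold all5, simp add: C5_def)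
  qed (auto simp: C5_def)
qed


section \<open>The free five-valued Nelson algebra on \<open>n\<close> generators\<close>

datatype nterm = Var nat | One | Neg nterm | Meet nterm nterm | Join nterm nterm | Imp nterm nterm

inductive_set terms :: "nat \<Rightarrow> nterm set" for n where
  "i \<in> {1..n} \<Longrightarrow> Var i \<in> terms n"
| "One \<in> terms n"
| "s \<in> terms n \<Longrightarrow> Neg s \<in> terms n"
| "s \<in> terms n \<Longrightarrow> t \<in> terms n \<Longrightarrow> Meet s t \<in> terms n"
| "s \<in> terms n \<Longrightarrow> t \<in> terms n \<Longrightarrow> Join s t \<in> terms n"
| "s \<in> terms n \<Longrightarrow> t \<in> terms n \<Longrightarrow> Imp s t \<in> terms n"

text \<open>Equational consequence of the axioms of five-valued Nelson algebras: the least congruence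
  of the term algebra that contains all instances of the axioms.\<close>

inductive nel_eq :: "nterm \<Rightarrow> nterm \<Rightarrow> bool"  (infix "\<approx>" 50) where
  refl: "s \<approx> s"
| sym: "s \<approx> t \<Longrightarrow> t \<approx> s"
| trans: "s \<approx> t \<Longrightarrow> t \<approx> u \<Longrightarrow> s \<approx> u"
| Neg: "s \<approx> s' \<Longrightarrow> Neg s \<approx> Neg s'"
| Meet: "s \<approx> s' \<Longrightarrow> t \<approx> t' \<Longrightarrow> Meet s t \<approx> Meet s' t'"
| Join: "s \<approx> s' \<Longrightarrow> t \<approx> t' \<Longrightarrow> Join s t \<approx> Join s' t'"
| Imp: "s \<approx> s' \<Longrightarrow> t \<approx> t' \<Longrightarrow> Imp s t \<approx> Imp s' t'"
| absorb: "Meet x (Join x y) \<approx> x"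
| distrib: "Meet x (Join y z) \<approx> Join (Meet z x) (Meet y x)"
| neg_neg: "Neg (Neg x) \<approx> x"
| neg_meet: "Neg (Meet x y) \<approx> Join (Neg x) (Neg y)"
| kleene: "Meet x (Neg x) \<approx> Meet (Meet x (Neg x)) (Join y (Neg y))"
| imp_self: "Imp x x \<approx> One"
| imp_imp: "Imp x (Imp y z) \<approx> Imp (Meet x y) z"
| meet_imp: "Meet x (Imp x y) \<approx> Meet x (Join (Neg x) y)"
| five_valued: "Imp (Imp (Imp x z) y) (Imp (Imp (Imp y x) y) y) \<approx> One"

definition cls :: "nat \<Rightarrow> nterm \<Rightarrow> nterm set" where
  "cls n s = {t \<in> terms n. s \<approx> t}"

definition F :: "nat \<Rightarrow> nterm set nelson_struct" where
  "F n = \<lparr> carrier = cls n ` terms n,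
           nel_one = cls n One,
           nel_neg = (\<lambda>X. \<Union>s\<in>X. cls n (Neg s)),
           nel_meet = (\<lambda>X Y. \<Union>s\<in>X. \<Union>t\<in>Y. cls n (Meet s t)),
           nel_join = (\<lambda>X Y. \<Union>s\<in>X. \<Union>t\<in>Y. cls n (Join s t)),
           nel_imp = (\<lambda>X Y. \<Union>s\<in>X. \<Union>t\<in>Y. cls n (Imp s t)) \<rparr>"

definition gen :: "nat \<Rightarrow> nat \<Rightarrow> nterm set" where
  "gen n i = cls n (Var i)"

definition G :: "nat \<Rightarrow> nterm set set" where
  "G n = gen n ` {1..n}"

lemma cls_eq_iff: "s \<in> terms n \<Longrightarrow> t \<in> terms n \<Longrightarrow> cls n s = cls n t \<longleftrightarrow> s \<approx> t"
  unfolding cls_def by (blast intro: nel_eq.refl nel_eq.sym nel_eq.trans)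

lemma mem_cls: "s \<in> terms n \<Longrightarrow> s \<in> cls n s"
  unfolding cls_def by (blast intro: nel_eq.refl)

lemma F_simps:
  "carrier (F n) = cls n ` terms n"
  "\<one>\<^bsub>F n\<^esub> = cls n One"
  "s \<in> terms n \<Longrightarrow> \<sim>\<^bsub>F n\<^esub> (cls n s) = cls n (Neg s)"
  "s \<in> terms n \<Longrightarrow> t \<in> terms n \<Longrightarrow> cls n s \<sqinter>\<^bsub>F n\<^esub> cls n t = cls n (Meet s t)"
  "s \<in> terms n \<Longrightarrow> t \<in> terms n \<Longrightarrow> cls n s \<squnion>\<^bsub>F n\<^esub> cls n t = cls n (Join s t)"
  "s \<in> terms n \<Longrightarrow> t \<in> terms n \<Longrightarrow> cls n s \<leadsto>\<^bsub>F n\<^esub> cls n t = cls n (Imp s t)"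
  by (auto simp: F_def cls_def intro: nel_eq.refl nel_eq.trans nel_eq.Neg nel_eq.Meet nel_eq.Join nel_eq.Imp)

lemma F_closed:
  "s \<in> terms n \<Longrightarrow> cls n s \<in> carrier (F n)"
  by (simp add: F_simps)

lemma Var_in_terms: "Suc 0 \<le> i \<Longrightarrow> i \<le> n \<Longrightarrow> Var i \<in> terms n"
  by (rule terms.intros(1)) simp

lemma five_valued_nelson_algebra_F: "five_valued_nelson_algebra (F n)"
proof -
  have cls_eqI: "cls n s = cls n t" if "s \<approx> t" for s t
    using that unfolding cls_def by (blast intro: nel_eq.sym nel_eq.trans)
  note [intro] = nel_eq.intros(8-)
  show ?thesis
    by unfold_locales
      (clarsimp simp: F_simps terms.intros, (rule imageI cls_eqI, force intro: terms.intros)?)+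
qed

lemma G_subset_F: "G n \<subseteq> carrier (F n)"
  by (auto simp: G_def gen_def F_simps Var_in_terms)

text \<open>Freeness of \<open>F n\<close>: for every algebra of the variety, on any type, each map on the
  generators extends to a unique homomorphism.\<close>

primrec eval :: "('a, 'm) nelson_struct_scheme \<Rightarrow> (nat \<Rightarrow> 'a) \<Rightarrow> nterm \<Rightarrow> 'a" where
  "eval A v (Var i) = v i"
| "eval A v One = \<one>\<^bsub>A\<^esub>"
| "eval A v (Neg s) = \<sim>\<^bsub>A\<^esub> (eval A v s)"
| "eval A v (Meet s t) = eval A v s \<sqinter>\<^bsub>A\<^esub> eval A v t"
| "eval A v (Join s t) = eval A v s \<squnion>\<^bsub>A\<^esub> eval A v t"
| "eval A v (Imp s t) = eval A v s \<leadsto>\<^bsub>A\<^esub> eval A v t"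

lemma eval_closed:
  assumes "five_valued_nelson_algebra A" "\<And>i. v i \<in> carrier A"
  shows "eval A v t \<in> carrier A"
proof -
  interpret five_valued_nelson_algebra A by fact
  show ?thesis by (induction t) (auto simp: assms(2))
qed

lemma eval_sound:
  assumes "five_valued_nelson_algebra A" "\<And>i. v i \<in> carrier A" "s \<approx> t"
  shows "eval A v s = eval A v t"
proof -
  interpret five_valued_nelson_algebra A by fact
  note [simp] = eval_closed[OF assms(1,2)]
  note distrib' = distrib and kleene' = kleene and five_valued' = five_valued
  from assms(3) show ?thesis
  proof (induction rule: nel_eq.induct)
    case (distrib x y z) show ?case unfolding eval.simps by (rule distrib') simp_all
  next
    case (kleene x y) show ?case unfolding eval.simps by (rule kleene') simp_all
  next
    case (five_valued x z y) show ?case unfolding eval.simps by (rule five_valued') simp_all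
  qed (simp_all add: absorb neg_neg neg_meet imp_self imp_imp meet_imp)
qed

theorem ex1_hom_extending:
  assumes A: "five_valued_nelson_algebra A" and f: "f \<in> G n \<rightarrow> carrier A"
  shows "\<exists>!\<phi>. \<phi> \<in> nelson_hom (F n) A \<and> (\<forall>g\<in>G n. \<phi> g = f g)"
proof (rule ex_ex1I)
  interpret five_valued_nelson_algebra A by fact
  define v where "v = (\<lambda>i. if i \<in> {1..n} then f (gen n i) else \<one>\<^bsub>A\<^esub>)"
  have v: "v i \<in> carrier A" for i
    using f by (auto simp: v_def G_def)
  define \<phi> where "\<phi> = restrict (\<lambda>X. eval A v (SOME s. s \<in> X)) (carrier (F n))"
  have \<phi>: "\<phi> (cls n s) = eval A v s" if "s \<in> terms n" for s
  proof -
    have "(SOME t. t \<in> cls n s) \<in> cls n s"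
      using mem_cls[OF that] by (rule someI)
    then have "s \<approx> (SOME t. t \<in> cls n s)" by (simp add: cls_def)
    from eval_sound[OF A v this] show ?thesis
      using that by (simp add: \<phi>_def F_simps)
  qed
  have "\<phi> \<in> nelson_hom (F n) A"
    unfolding nelson_hom_def
    by (auto simp: F_simps \<phi> terms.intros eval_closed[OF A v])
       (auto simp: \<phi>_def F_simps)
  moreover have "\<forall>g\<in>G n. \<phi> g = f g"
    by (auto simp: G_def gen_def \<phi> Var_in_terms) (auto simp: v_def gen_def)
  ultimately show "\<exists>\<phi>. \<phi> \<in> nelson_hom (F n) A \<and> (\<forall>g\<in>G n. \<phi> g = f g)" by blast
next
  fix \<phi> \<psi>
  assume h: "\<phi> \<in> nelson_hom (F n) A \<and> (\<forall>g\<in>G n. \<phi> g = f g)"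
    "\<psi> \<in> nelson_hom (F n) A \<and> (\<forall>g\<in>G n. \<psi> g = f g)"
  have "\<phi> (cls n s) = \<psi> (cls n s)" if "s \<in> terms n" for s
    using that
  proof (induction rule: terms.induct)
    case (1 i)
    then have "cls n (Var i) \<in> G n" by (auto simp: G_def gen_def)
    then show ?case using h by auto
  next
    case 2 show ?case using h by (simp add: nelson_hom_def F_simps)
  next
    case (3 s) then show ?case using h
      by (simp add: nelson_hom_def F_closed flip: F_simps(3))
  next
    case (4 s t) then show ?case using h
      by (simp add: nelson_hom_def F_closed flip: F_simps(4))
  next
    case (5 s t) then show ?case using h
      by (simp add: nelson_hom_def F_closed flip: F_simps(5))
  next
    case (6 s t) then show ?case using h
      by (simp add: nelson_hom_def F_closed flip: F_simps(6))
  qed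
  then have eq: "\<forall>x\<in>carrier (F n). \<phi> x = \<psi> x" by (auto simp: F_simps)
  have "\<phi> \<in> carrier (F n) \<rightarrow>\<^sub>E carrier A" "\<psi> \<in> carrier (F n) \<rightarrow>\<^sub>E carrier A"
    using h by (auto simp: nelson_hom_def)
  then show "\<phi> = \<psi>" using eq by (auto intro: PiE_ext)
qed

lemma inj_on_gen: "inj_on (gen n) {1..n}"
proof (rule inj_onI)
  fix i j assume ij: "i \<in> {1..n}" "j \<in> {1..n}" "gen n i = gen n j"
  then have e: "Var i \<approx> Var j" by (simp add: gen_def cls_eq_iff Var_in_terms)
  have "eval C5 (\<lambda>k. if k = i then 1 else 0) (Var i) = eval C5 (\<lambda>k. if k = i then 1 else 0) (Var j)"
    by (rule eval_sound[OF five_valued_nelson_algebra_C5 _ e]) (simp add: C5_def)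
  then show "i = j" by (auto split: if_splits)
qed

lemma card_G: "card (G n) = n"
  unfolding G_def using card_image[OF inj_on_gen, of n] by simp


section \<open>The sets \<open>P\<^sub>f\<close>\<close>

definition hom_ext :: "nat \<Rightarrow> (nterm set \<Rightarrow> rat) \<Rightarrow> nterm set \<Rightarrow> rat" where
  "hom_ext n f = (THE \<phi>. \<phi> \<in> nelson_hom (F n) C5 \<and> (\<forall>g\<in>G n. \<phi> g = f g))"

definition P :: "nat \<Rightarrow> (nterm set \<Rightarrow> rat) \<Rightarrow> nterm set set" where
  "P n f = {x \<in> carrier (F n). hom_ext n f x = 1}"

lemma hom_ext:
  assumes "f \<in> G n \<rightarrow> carrier C5"
  shows "hom_ext n f \<in> nelson_hom (F n) C5" "g \<in> G n \<Longrightarrow> hom_ext n f g = f g"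
  using theI'[OF ex1_hom_extending[OF five_valued_nelson_algebra_C5 assms]]
  by (auto simp: hom_ext_def)

end

(* The map c on C5 that rounds 1/4 to 0 and 3/4 to 1 is an endomorphism with image {0, 1/2, 1}.
   Conditions (1) and (3)-(5) say that f = c o h on the generators, hence everywhere. So they
   give P_h \<subseteq> P_f, and the inclusion is strict as soon as some h_i is 1/4 or 3/4.
   Conversely, u = x \<rightarrow> ~x has value 1 exactly where x \<le> 1/2, and u \<rightarrow> ~u exactly where
   x > 1/2, so P_h \<subseteq> P_f forces c o f = c o h. If b lies in P_f but not in P_h, then b has
   value 3/4 under h and 1 under f; an element a with value 3/4 under f has the same value
   under h, and b \<rightarrow> a would lie in P_h but not in P_f. So f takes no value 1/4 or 3/4. *)

theory Submission
  imports Defs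
begin

definition coarse :: "rat \<Rightarrow> rat" where
  "coarse x = (if x < 1/2 then 0 else if x = 1/2 then 1/2 else 1)"

lemma carrier_C5: "carrier C5 = {0, 1/4, 1/2, 3/4, 1}"
  by (simp add: C5_def)

lemma nelson_homD:
  assumes "\<phi> \<in> nelson_hom A B"
  shows "x \<in> carrier A \<Longrightarrow> \<phi> x \<in> carrier B"
    and "\<phi> \<one>\<^bsub>A\<^esub> = \<one>\<^bsub>B\<^esub>"
    and "x \<in> carrier A \<Longrightarrow> \<phi> (\<sim>\<^bsub>A\<^esub> x) = \<sim>\<^bsub>B\<^esub> (\<phi> x)"
    and "x \<in> carrier A \<Longrightarrow> y \<in> carrier A \<Longrightarrow> \<phi> (x \<sqinter>\<^bsub>A\<^esub> y) = \<phi> x \<sqinter>\<^bsub>B\<^esub> \<phi> y"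
    and "x \<in> carrier A \<Longrightarrow> y \<in> carrier A \<Longrightarrow> \<phi> (x \<squnion>\<^bsub>A\<^esub> y) = \<phi> x \<squnion>\<^bsub>B\<^esub> \<phi> y"
    and "x \<in> carrier A \<Longrightarrow> y \<in> carrier A \<Longrightarrow> \<phi> (x \<leadsto>\<^bsub>A\<^esub> y) = \<phi> x \<leadsto>\<^bsub>B\<^esub> \<phi> y"
  using assms by (auto simp: nelson_hom_def)

lemma nelson_hom_comp:
  assumes "nelson_algebra A" "\<phi> \<in> nelson_hom A B" "\<psi> \<in> nelson_hom B C"
  shows "restrict (\<psi> \<circ> \<phi>) (carrier A) \<in> nelson_hom A C"
proof -
  interpret nelson_algebra A by fact
  show ?thesis
    by (auto simp: nelson_hom_def nelson_homD[OF assms(2)] nelson_homD[OF assms(3)])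
qed

text \<open>Rounding is monotone and commutes with negation. For implication the delicate pair is 1,
  3/4: the value 3/4 rounds to 1, which is also the implication of the rounded values. The
  restriction is there because homomorphisms are extensional.\<close>

lemma coarse_hom: "restrict coarse (carrier C5) \<in> nelson_hom C5 C5"
  by (auto simp: nelson_hom_def C5_def coarse_def)

text \<open>The side of 1/2 on which a value lies can be tested by terms with value 1, and such
  tests pass from \<open>\<phi>\<close> to \<open>\<psi>\<close>. Testing both \<open>a\<close> and
  its negation separates below, equal to and above 1/2.\<close>

lemma coarse_eq_if_unit_subset:
  assumes A: "nelson_algebra A"
    and \<phi>: "\<phi> \<in> nelson_hom A C5" and \<psi>: "\<psi> \<in> nelson_hom A C5"
    and sub: "\<And>a. a \<in> carrier A \<Longrightarrow> \<phi> a = 1 \<Longrightarrow> \<psi> a = 1"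
    and a: "a \<in> carrier A"
  shows "coarse (\<psi> a) = coarse (\<phi> a)"
proof -
  interpret A: nelson_algebra A by fact
  note hom = nelson_homD[OF \<phi>] nelson_homD[OF \<psi>]
  have C5_neg: "\<sim>\<^bsub>C5\<^esub> x = 1 - x"
    and C5_imp: "x \<leadsto>\<^bsub>C5\<^esub> y = (if x \<le> y \<or> x \<le> 1 - x then 1 else max (1 - x) y)" for x y
    by (simp_all add: C5_def)
  have gt: "\<psi> x > 1/2" if x: "x \<in> carrier A" and "\<phi> x > 1/2" for x
  proof -
    \<comment> \<open>If the value v of \<open>x\<close> is at most 1/2, then \<open>?u\<close> is 1
      and the term built from it is 0; otherwise \<open>?u\<close> is 1 - v < 1/2 and the term is
      1.\<close>
    let ?u = "x \<leadsto>\<^bsub>A\<^esub> \<sim>\<^bsub>A\<^esub> x"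
    have "\<phi> (?u \<leadsto>\<^bsub>A\<^esub> \<sim>\<^bsub>A\<^esub> ?u) = 1"
      using that by (simp add: hom C5_neg C5_imp)
    then have "\<psi> (?u \<leadsto>\<^bsub>A\<^esub> \<sim>\<^bsub>A\<^esub> ?u) = 1"
      using sub x by simp
    then show ?thesis
      using x by (simp add: hom C5_neg C5_imp split: if_splits)
  qed
  have le: "\<psi> x \<le> 1/2" if x: "x \<in> carrier A" and "\<phi> x \<le> 1/2" for x
  proof -
    have "\<phi> (x \<leadsto>\<^bsub>A\<^esub> \<sim>\<^bsub>A\<^esub> x) = 1"
      using that by (simp add: hom C5_neg C5_imp)
    then have "\<psi> (x \<leadsto>\<^bsub>A\<^esub> \<sim>\<^bsub>A\<^esub> x) = 1"
      using sub x by simp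
    then show ?thesis
      using x by (simp add: hom C5_neg C5_imp split: if_splits)
  qed
  have "\<phi> (\<sim>\<^bsub>A\<^esub> a) = 1 - \<phi> a" "\<psi> (\<sim>\<^bsub>A\<^esub> a) = 1 - \<psi> a"
    using a by (simp_all add: hom C5_neg)
  then show ?thesis
    using gt[of a] gt[of "\<sim>\<^bsub>A\<^esub> a"] le[of a] le[of "\<sim>\<^bsub>A\<^esub> a"] a
    by (cases "\<phi> a" "1/2 :: rat" rule: linorder_cases) (auto simp: coarse_def)
qed

text \<open>The argument works elementwise in any Nelson algebra; freeness enters only later, to
  reduce the right-hand side to generators.\<close>

lemma unit_psubset_iff:
  assumes A: "nelson_algebra A"
    and \<phi>: "\<phi> \<in> nelson_hom A C5" and \<psi>: "\<psi> \<in> nelson_hom A C5"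
  shows "{a \<in> carrier A. \<phi> a = 1} \<subset> {a \<in> carrier A. \<psi> a = 1} \<longleftrightarrow>
    (\<forall>a\<in>carrier A. \<psi> a = coarse (\<phi> a)) \<and> (\<exists>a\<in>carrier A. \<phi> a \<noteq> \<psi> a)"
    (is "?L \<longleftrightarrow> ?R")
proof
  interpret A: nelson_algebra A by fact
  note hom = nelson_homD[OF \<phi>] nelson_homD[OF \<psi>]
  have neg: "\<phi> (\<sim>\<^bsub>A\<^esub> a) = 1 - \<phi> a" "\<psi> (\<sim>\<^bsub>A\<^esub> a) = 1 - \<psi> a" if "a \<in> carrier A" for a
    using that by (simp_all add: hom) (simp_all add: C5_def)
  {
    assume ?L
    then have sub: "\<psi> a = 1" if "a \<in> carrier A" "\<phi> a = 1" for a
      using that by blast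
    have co: "coarse (\<psi> a) = coarse (\<phi> a)" if "a \<in> carrier A" for a
      using coarse_eq_if_unit_subset[OF A \<phi> \<psi> sub that] .
    obtain b where b: "b \<in> carrier A" "\<phi> b \<noteq> 1" "\<psi> b = 1"
      using \<open>?L\<close> by blast
    \<comment> \<open>Among the five values, \<open>coarse\<close> sends only 3/4 and 1 to
      1.\<close>
    have \<phi>b: "\<phi> b = 3/4"
      using co[OF b(1)] hom(1)[OF b(1)] b by (auto simp: coarse_def carrier_C5)
    have no34: "\<psi> a \<noteq> 3/4" if a: "a \<in> carrier A" for a
    proof
      assume \<psi>a: "\<psi> a = 3/4"
      then have "\<phi> a = 3/4"
        using co[OF a] hom(1)[OF a] sub[OF a] by (auto simp: coarse_def carrier_C5)
      then have "\<phi> (b \<leadsto>\<^bsub>A\<^esub> a) = 1"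
        using \<phi>b a b by (simp add: hom) (simp add: C5_def)
      moreover have "\<psi> (b \<leadsto>\<^bsub>A\<^esub> a) = 3/4"
        using \<psi>a a b by (simp add: hom) (simp add: C5_def)
      ultimately show False
        using sub[of "b \<leadsto>\<^bsub>A\<^esub> a"] a b by simp
    qed
    \<comment> \<open>\<open>no34\<close> at the negation of \<open>a\<close> rules out the value
      1/4 as well, so \<open>coarse\<close> fixes \<open>\<psi> a\<close>.\<close>
    have "\<psi> a = coarse (\<phi> a)" if a: "a \<in> carrier A" for a
      using co[OF a] hom(7)[OF a] no34[OF a] no34[of "\<sim>\<^bsub>A\<^esub> a"] neg[OF a] a
      by (auto simp: coarse_def carrier_C5)
    moreover have "\<phi> b \<noteq> \<psi> b"
      using b by simp
    ultimately show ?R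
      using b(1) by blast
  next
    assume R: ?R
    then obtain a where a: "a \<in> carrier A" "\<phi> a \<noteq> \<psi> a" by blast
    \<comment> \<open>Rounding moves \<open>\<phi> a\<close>, so it is 3/4 or 1/4; the first makes
      \<open>a\<close> a witness of strictness, the second its negation.\<close>
    have "(\<phi> a \<noteq> 1 \<and> \<psi> a = 1) \<or> (\<phi> (\<sim>\<^bsub>A\<^esub> a) \<noteq> 1 \<and> \<psi> (\<sim>\<^bsub>A\<^esub> a) = 1)"
      using R a hom(1)[OF a(1)] neg[OF a(1)] by (auto simp: coarse_def carrier_C5)
    then have "\<exists>b\<in>carrier A. \<phi> b \<noteq> 1 \<and> \<psi> b = 1"
      using a by blast
    moreover have "\<psi> a = 1" if "a \<in> carrier A" "\<phi> a = 1" for a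
      using that R by (simp add: coarse_def)
    ultimately show ?L by blast
  }
qed

text \<open>This is the uniqueness half of freeness, with the values of \<open>\<psi>\<close> on the
  generators as the prescribed map.\<close>

lemma hom_F_eqI:
  assumes "five_valued_nelson_algebra A"
    and "\<phi> \<in> nelson_hom (F n) A" "\<psi> \<in> nelson_hom (F n) A" "\<And>g. g \<in> G n \<Longrightarrow> \<phi> g = \<psi> g"
  shows "\<phi> = \<psi>"
proof -
  have "\<psi> \<in> G n \<rightarrow> carrier A"
    using nelson_homD(1)[OF assms(3)] G_subset_F by blast
  from ex1_hom_extending[OF assms(1) this] show ?thesis
    using assms(2-4) by blast
qed

theorem theorem4p8:
  fixes n :: nat and f h :: "nterm set \<Rightarrow> rat"
  assumes "n \<ge> 1"
    and "f \<in> G n \<rightarrow> carrier C5"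
    and "h \<in> G n \<rightarrow> carrier C5"
  shows "P n h \<subset> P n f \<longleftrightarrow>
      (\<forall>i\<in>{1..n}. f (gen n i) \<in> {0, 1/2, 1}) \<and>
      (\<exists>i\<in>{1..n}. f (gen n i) \<noteq> h (gen n i)) \<and>
      (\<forall>i\<in>{1..n}. f (gen n i) = 0 \<longrightarrow> h (gen n i) \<in> {0, 1/4}) \<and>
      (\<forall>i\<in>{1..n}. f (gen n i) = 1 \<longrightarrow> h (gen n i) \<in> {1, 3/4}) \<and>
      (\<forall>i\<in>{1..n}. h (gen n i) = 1/2 \<longleftrightarrow> f (gen n i) = 1/2)"
proof -
  interpret F: five_valued_nelson_algebra "F n"
    by (rule five_valued_nelson_algebra_F)
  let ?\<phi> = "hom_ext n h" and ?\<psi> = "hom_ext n f"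
  have \<phi>: "?\<phi> \<in> nelson_hom (F n) C5" and \<psi>: "?\<psi> \<in> nelson_hom (F n) C5"
    using hom_ext(1) assms by blast+
  have \<phi>_gen: "?\<phi> g = h g" and \<psi>_gen: "?\<psi> g = f g" if "g \<in> G n" for g
    using hom_ext(2) assms that by blast+
  have coarse_iff: "(\<forall>a\<in>carrier (F n). ?\<psi> a = coarse (?\<phi> a)) \<longleftrightarrow> (\<forall>g\<in>G n. f g = coarse (h g))"
  proof
    assume "\<forall>a\<in>carrier (F n). ?\<psi> a = coarse (?\<phi> a)"
    then show "\<forall>g\<in>G n. f g = coarse (h g)"
      using G_subset_F \<phi>_gen \<psi>_gen by fastforce
  next
    assume fh: "\<forall>g\<in>G n. f g = coarse (h g)"
    \<comment> \<open>Rounding after \<open>?\<phi>\<close>, made extensional so that it can equal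
      \<open>?\<psi>\<close> as a function.\<close>
    let ?\<chi> = "restrict (restrict coarse (carrier C5) \<circ> ?\<phi>) (carrier (F n))"
    have \<chi>: "?\<chi> a = coarse (?\<phi> a)" if "a \<in> carrier (F n)" for a
      using that nelson_homD(1)[OF \<phi>] by simp
    have "?\<psi> = ?\<chi>"
    proof (rule hom_F_eqI[OF five_valued_nelson_algebra_C5 \<psi>])
      show "?\<chi> \<in> nelson_hom (F n) C5"
        by (rule nelson_hom_comp[OF F.nelson_algebra_axioms \<phi> coarse_hom])
      show "?\<psi> g = ?\<chi> g" if "g \<in> G n" for g
        using that fh \<chi> G_subset_F \<phi>_gen \<psi>_gen by (metis subsetD)
    qed
    then show "\<forall>a\<in>carrier (F n). ?\<psi> a = coarse (?\<phi> a)"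
      using \<chi> by metis
  qed
  have differ_iff: "(\<exists>a\<in>carrier (F n). ?\<phi> a \<noteq> ?\<psi> a) \<longleftrightarrow> (\<exists>g\<in>G n. f g \<noteq> h g)"
    using hom_F_eqI[OF five_valued_nelson_algebra_C5 \<phi> \<psi>] G_subset_F \<phi>_gen \<psi>_gen
    by (metis subsetD)
  have "P n h \<subset> P n f \<longleftrightarrow> (\<forall>g\<in>G n. f g = coarse (h g)) \<and> (\<exists>g\<in>G n. f g \<noteq> h g)"
    unfolding P_def unit_psubset_iff[OF F.nelson_algebra_axioms \<phi> \<psi>] coarse_iff differ_iff ..
  also have "\<dots> \<longleftrightarrow> (\<forall>i\<in>{1..n}. f (gen n i) = coarse (h (gen n i))) \<and>
      (\<exists>i\<in>{1..n}. f (gen n i) \<noteq> h (gen n i))"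
    by (simp add: G_def)
  also have "(\<forall>i\<in>{1..n}. f (gen n i) = coarse (h (gen n i))) \<longleftrightarrow>
      (\<forall>i\<in>{1..n}. f (gen n i) \<in> {0, 1/2, 1} \<and>
        (f (gen n i) = 0 \<longrightarrow> h (gen n i) \<in> {0, 1/4}) \<and>
        (f (gen n i) = 1 \<longrightarrow> h (gen n i) \<in> {1, 3/4}) \<and>
        (h (gen n i) = 1/2 \<longleftrightarrow> f (gen n i) = 1/2))"
  proof (rule ball_cong[OF HOL.refl])
    fix i assume "i \<in> {1..n}"
    \<comment> \<open>Membership in the chain is what turns a rounded value 0 into 0 or 1/4, and a
      rounded value 1 into 1 or 3/4.\<close>
    then have "h (gen n i) \<in> {0, 1/4, 1/2, 3/4, 1}"
      using assms(3) by (auto simp: G_def C5_def)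
    then show "f (gen n i) = coarse (h (gen n i)) \<longleftrightarrow>
        f (gen n i) \<in> {0, 1/2, 1} \<and>
        (f (gen n i) = 0 \<longrightarrow> h (gen n i) \<in> {0, 1/4}) \<and>
        (f (gen n i) = 1 \<longrightarrow> h (gen n i) \<in> {1, 3/4}) \<and>
        (h (gen n i) = 1/2 \<longleftrightarrow> f (gen n i) = 1/2)"
      by (auto simp: coarse_def)
  qed
  finally show ?thesis by blast
qed

end
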